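(* Let $n\ge1$. The number of affine equivalence classes of $n\times n$ $0$-$1$ circulants of weight $2$ is $\tau(n)-1$, where $\tau(n)$ is the number of positive divisors of $n$. Furthermore, if $A,B$ are $n\times n$ $0$-$1$ circulants of weight $2$ that are not affinely equivalent, then $AA^T$ and $BB^T$ are not similar.
   Context: Rows and columns are indexed by $0,\dots,n-1$. A $0$-$1$ circulant is an $n\times n$ matrix $A$ with entries in $\{0,1\}$ such that $A_{i,j}$ depends only on $j-i\bmod n$; its residue set $S_A\subseteq\mathbb{Z}/n\mathbb{Z}$ is the set of columns where the top row has a $1$ (so $A_{i,j}=1$ iff $j-i\in S_A$), and its weight is $|S_A|$. Two such circulants $A,B$ are affinely equivalent if there exist $u,v\in\mathbb{Z}/n\mathbb{Z}$, $u$ a unit, with $S_B=uS_A+v$. *)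

theory Defs
  imports "Jordan_Normal_Form.Char_Poly" "HOL-Number_Theory.Cong"
begin

definition zero_one_circulant :: "nat \<Rightarrow> 'a::{zero,one} mat \<Rightarrow> bool" where
  "zero_one_circulant n A \<longleftrightarrow>
     A \<in> carrier_mat n n \<and>
     (\<forall>i<n. \<forall>j<n. A $$ (i, j) \<in> {0, 1}) \<and>
     (\<forall>i<n. \<forall>j<n. \<forall>i'<n. \<forall>j'<n.
        [int j - int i = int j' - int i'] (mod int n) \<longrightarrow> A $$ (i, j) = A $$ (i', j'))"

text \<open>Elements of \<open>\<int>/n\<int>\<close> are represented by their remainders in \<open>{0..<n}\<close>.\<close>

definition residue_set :: "'a::{zero,one} mat \<Rightarrow> nat set" where
  "residue_set A = {j. j < dim_col A \<and> A $$ (0, j) = 1}"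

definition weight :: "'a::{zero,one} mat \<Rightarrow> nat" where
  "weight A = card (residue_set A)"

text \<open>For \<open>n = 1\<close> the residue \<open>u = 0\<close> is a unit, in agreement with \<open>coprime 0 1\<close>.\<close>

definition affinely_equivalent :: "nat \<Rightarrow> 'a::{zero,one} mat \<Rightarrow> 'a mat \<Rightarrow> bool" where
  "affinely_equivalent n A B \<longleftrightarrow>
     (\<exists>u<n. \<exists>v<n. coprime u n \<and> residue_set B = (\<lambda>s. (u * s + v) mod n) ` residue_set A)"

definition affine_equivalence :: "nat \<Rightarrow> ('a::{zero,one} mat \<times> 'a mat) set" where
  "affine_equivalence n =
     {(A, B). zero_one_circulant n A \<and> zero_one_circulant n B \<and> affinely_equivalent n A B}"

end

(* The residue set {a, b} of a weight 2 circulant A is determined up to affine equivalence by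
   d = gcd(n, a - b), a proper divisor of n, because a unit modulo n/d lifts to a unit modulo n.

   This d is recovered from A A^T as the dimension of the eigenspace for 4: reading vectors as
   n-periodic functions f on the integers and putting k = a - b, the equation A A^T f = 4 f says
   f(i + k) + f(i - k) = 2 f(i), which forces f(i + k) = f(i), so the eigenspace consists of the
   d-periodic functions. The dimension is handled as the trace d of the projection f |-> f(i mod d). *)
theory Submission
  imports Defs
begin

section \<open>Affine equivalence of two-element sets modulo n\<close>

text \<open>For \<open>m\<close> dividing \<open>n\<close> this makes reduction from units modulo
  \<open>n\<close> to units modulo \<open>m\<close> surjective. It suffices to choose
  \<open>t\<close> so that no prime factor of \<open>n\<close> divides
  \<open>w + m * t\<close>.\<close>

lemma unit_lift:
  fixes w m n :: nat
  assumes "coprime w m" "n > 0"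
  shows "\<exists>t. coprime (w + m * t) n"
proof -
  \<comment> \<open>Every prime factor of \<open>n\<close> divides exactly one of \<open>w\<close> and \<open>m * \<Prod>P\<close>.\<close>
  define P where "P = {p. prime p \<and> p dvd n \<and> \<not> p dvd w}"
  have fin: "finite P"
    by (rule finite_subset[of _ "{..n}"]) (use assms in \<open>auto simp: P_def dest: dvd_imp_le\<close>)
  have "\<not> p dvd w + m * \<Prod>P" if p: "prime p" "p dvd n" for p
  proof (cases "p dvd w")
    case True
    then have "\<not> p dvd m"
      using assms(1) p(1) by (meson not_coprimeI prime_nat_iff not_prime_unit)
    moreover have "\<not> p dvd \<Prod>P"
    proof
      assume "p dvd \<Prod>P"
      then obtain q where q: "q \<in> P" "p dvd q"
        using p(1) fin by (auto simp: prime_dvd_prod_iff)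
      then have "p = q" using p(1) by (auto simp: P_def primes_dvd_imp_eq)
      then show False using q True by (auto simp: P_def)
    qed
    ultimately show ?thesis
      using True p(1) by (simp add: dvd_add_right_iff prime_dvd_mult_iff)
  next
    case False
    then have "p dvd m * \<Prod>P"
      using p fin by (auto simp: P_def intro!: dvd_mult dvd_prodI[of P _ "\<lambda>x. x", simplified])
    then show ?thesis using False by (simp add: dvd_add_left_iff)
  qed
  then have "coprime (w + m * \<Prod>P) n"
    by (meson coprime_iff_gcd_eq_1 gcd_dvd1 gcd_dvd2 dvd_trans prime_factor_nat)
  then show ?thesis ..
qed

text \<open>Divided by the common gcd \<open>d\<close>, both \<open>x\<close> and \<open>y\<close>
  become units modulo \<open>m = n / d\<close>. Their quotient is a unit modulo \<open>m\<close>,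
  which is lifted to a unit \<open>u\<close> modulo \<open>n\<close>; multiplying the congruence
  modulo \<open>m\<close> by \<open>d\<close> turns it into one modulo \<open>n\<close>.\<close>

lemma unit_multiple_of_gcd_eq:
  fixes x y :: int and n :: nat
  assumes "n > 0" "gcd (int n) x = gcd (int n) y"
  obtains u where "u < n" "coprime u n" "[int u * x = y] (mod int n)"
proof -
  define d where "d = gcd (int n) x"
  have d: "d > 0" using assms(1) by (simp add: d_def)
  define m where "m = nat (int n div d)"
  have "int m = int n div d" using d by (simp add: m_def pos_imp_zdiv_nonneg_iff)
  then have n: "int n = d * int m" by (simp add: d_def)
  obtain x' where x': "x = d * x'" using gcd_dvd2[of "int n" x] unfolding d_def dvd_def by metis
  obtain y' where y': "y = d * y'" using gcd_dvd2[of "int n" y] assms(2) unfolding d_def dvd_def by metis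
  have "gcd (d * int m) (d * x') = d" by (metis d_def n x')
  then have "d * gcd (int m) x' = d" using d by (simp add: gcd_mult_left)
  then have cx: "coprime x' (int m)" using d by (simp add: coprime_iff_gcd_eq_1 gcd.commute)
  have "gcd (d * int m) (d * y') = d" by (metis d_def assms(2) n y')
  then have "d * gcd (int m) y' = d" using d by (simp add: gcd_mult_left)
  then have cy: "coprime y' (int m)" using d by (simp add: coprime_iff_gcd_eq_1 gcd.commute)
  have m: "m > 0" using n assms(1) by (cases m) auto
  \<comment> \<open>\<open>z\<close> inverts \<open>x'\<close> modulo \<open>m\<close>, so
    \<open>w\<close> represents the quotient of \<open>y'\<close> by \<open>x'\<close>.\<close>
  obtain z where z: "[x' * z = 1] (mod int m)" using cong_solve_coprime_int[OF cx] by blast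
  define w where "w = nat ((z * y') mod int m)"
  have w: "int w = (z * y') mod int m" using m by (simp add: w_def)
  have "coprime z (int m)" using z by (metis coprime_mult_left_iff cong_imp_coprime cong_sym coprime_1_left)
  then have "coprime (int w) (int m)" unfolding w using cy m by simp
  then have "coprime w m" by simp
  then obtain t where t: "coprime (w + m * t) n" using unit_lift assms(1) by blast
  define u where "u = (w + m * t) mod n"
  have "[int u * x' = y'] (mod int m)"
  proof -
    \<comment> \<open>Reducing modulo \<open>n\<close> does not disturb the residue modulo
      \<open>m\<close>, because \<open>m\<close> divides \<open>n\<close>.\<close>
    have "[int u = int (w + m * t)] (mod int n)" by (simp add: u_def zmod_int)
    then have "[int u = int (w + m * t)] (mod int m)" using n by (auto intro: cong_dvd_modulus)
    also have "[int (w + m * t) = z * y'] (mod int m)" by (simp add: cong_def w)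
    finally have "[int u * x' = z * y' * x'] (mod int m)" by (rule cong_scalar_right)
    also have "[z * y' * x' = 1 * y'] (mod int m)"
      using cong_scalar_right[OF z, of y'] by (simp add: ac_simps)
    finally show ?thesis by simp
  qed
  then have "[int u * x = y] (mod int n)"
    unfolding x' y' n cong_iff_dvd_diff using d
    by (simp add: mult.left_commute[of "int u"] flip: right_diff_distrib)
  moreover have "u < n" "coprime u n" using t assms(1) by (auto simp: u_def)
  ultimately show thesis using that by blast
qed

text \<open>Multiplication by a unit preserves \<open>gcd n (a - b)\<close>, and this is the complete affine invariant
  of a two-element set \<open>{a, b}\<close>; \<open>Max\<close> and \<open>Min\<close> merely pick its two elements.\<close>

definition gap :: "nat \<Rightarrow> nat set \<Rightarrow> nat" where
  "gap n S = gcd n (Max S - Min S)"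

text \<open>The natural-number subtraction in \<open>gap\<close> never truncates, and a gcd ignores
  signs. The signed difference thus serves for either order of \<open>a\<close> and
  \<open>b\<close>.\<close>

lemma int_gap_pair: "int (gap n {a, b}) = gcd (int n) (int a - int b)"
proof (cases "a \<le> b")
  case True
  then have "int (gap n {a, b}) = gcd (int n) (int b - int a)"
    by (simp add: gap_def max_def min_def of_nat_diff flip: gcd_int_int_eq)
  then show ?thesis by (metis gcd_neg2_int minus_diff_eq)
next
  case False
  then show ?thesis
    by (simp add: gap_def max_def min_def of_nat_diff flip: gcd_int_int_eq)
qed

lemma int_affine_diff_cong:
  fixes u v a b n :: nat
  shows "[int ((u * a + v) mod n) - int ((u * b + v) mod n) = int u * (int a - int b)] (mod int n)"
  by (simp add: cong_def zmod_int mod_simps algebra_simps)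

text \<open>Translations cancel in differences, and a unit factor does not change the gcd with
  \<open>n\<close>. Conversely, \<open>u\<close> is chosen to carry \<open>a - b\<close> to
  \<open>c - e\<close>; once \<open>v\<close> makes \<open>a\<close> go to \<open>c\<close>, the
  point \<open>b\<close> must go to \<open>e\<close>.\<close>

lemma affine_image_pair_iff:
  fixes n a b c e :: nat
  assumes "a < n" "b < n" "c < n" "e < n"
  shows "(\<exists>u<n. \<exists>v<n. coprime u n \<and> {c, e} = (\<lambda>s. (u * s + v) mod n) ` {a, b})
           \<longleftrightarrow> gap n {a, b} = gap n {c, e}"
proof
  assume "\<exists>u<n. \<exists>v<n. coprime u n \<and> {c, e} = (\<lambda>s. (u * s + v) mod n) ` {a, b}"
  then obtain u v where u: "coprime u n" "{c, e} = {(u * a + v) mod n, (u * b + v) mod n}" by auto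
  have "int (gap n {c, e}) = gcd (int n) (int u * (int a - int b))"
    \<comment> \<open>\<open>gap\<close> sees only the unordered pair, so it does not matter which
      of \<open>c\<close> and \<open>e\<close> is the image of \<open>a\<close>.\<close>
    unfolding u(2) int_gap_pair
    using cong_gcd_eq[OF int_affine_diff_cong[of u a v n b]] by (simp add: gcd.commute)
  also have "\<dots> = int (gap n {a, b})"
    unfolding int_gap_pair using u(1) by (simp add: gcd_mult_left_left_cancel coprime_commute gcd_mult_right_left_cancel)
  finally show "gap n {a, b} = gap n {c, e}" by simp
next
  assume "gap n {a, b} = gap n {c, e}"
  then have "gcd (int n) (int a - int b) = gcd (int n) (int c - int e)"
    by (metis int_gap_pair)
  moreover have n: "n > 0" using assms by simp
  ultimately obtain u where u: "u < n" "coprime u n" "[int u * (int a - int b) = int c - int e] (mod int n)"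
    using unit_multiple_of_gcd_eq by metis
  define v where "v = nat ((int c - int u * int a) mod int n)"
  have v: "int v = (int c - int u * int a) mod int n" "v < n" using n by (auto simp: v_def nat_less_iff)
  have *: "[int (u * s + v) = int c - int u * (int a - int s)] (mod int n)" for s
    by (simp add: cong_def v mod_simps algebra_simps)
  have "[int (u * a + v) = int c] (mod int n)" using *[of a] by simp
  moreover have "[int (u * b + v) = int e] (mod int n)"
    using cong_trans[OF *[of b] cong_diff[OF cong_refl[of "int c"] u(3)]] by simp
  ultimately have "(u * a + v) mod n = c" "(u * b + v) mod n = e"
    using assms unfolding cong_int_iff by (auto simp: cong_def)
  then show "\<exists>u<n. \<exists>v<n. coprime u n \<and> {c, e} = (\<lambda>s. (u * s + v) mod n) ` {a, b}"
    using u v by auto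
qed

section \<open>The eigenspace for 4\<close>

lemma residue_set_subset:
  assumes "zero_one_circulant n A"
  shows "residue_set A \<subseteq> {..<n}"
  using assms by (auto simp: zero_one_circulant_def residue_set_def)

lemma circulant_entry:
  fixes A :: "'a::zero_neq_one mat"
  assumes A: "zero_one_circulant n A" and "i < n" "j < n"
  shows "A $$ (i, j) = (if nat ((int j - int i) mod int n) \<in> residue_set A then 1 else 0)"
proof -
  define s where "s = nat ((int j - int i) mod int n)"
  have n: "0 < n" using assms by simp
  have s: "s < n" "int s = (int j - int i) mod int n"
    using n by (auto simp: s_def nat_less_iff)
  \<comment> \<open>The positions \<open>(0, s)\<close> and \<open>(i, j)\<close> lie on the same
    cyclic diagonal.\<close>
  have "[int s - int 0 = int j - int i] (mod int n)"
    using s by (simp add: cong_def)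
  then have "A $$ (0, s) = A $$ (i, j)"
    using A n assms(2,3) s(1) unfolding zero_one_circulant_def by metis
  moreover have "A $$ (i, j) \<in> {0, 1}"
    using assms unfolding zero_one_circulant_def by blast
  ultimately show ?thesis
    using A s(1) unfolding s_def[symmetric]
    by (auto simp: residue_set_def zero_one_circulant_def)
qed

lemma weight_2_residue_set:
  assumes "zero_one_circulant n A" "weight A = 2"
  obtains a b where "residue_set A = {a, b}" "a \<noteq> b" "a < n" "b < n"
  using assms residue_set_subset[OF assms(1)] by (auto simp: weight_def card_2_iff)

text \<open>The entry is solved once for the column and once for the row, so that the indicators
  collapse the sums in products with \<open>A\<close> and with its transpose. As \<open>a\<close>
  and \<open>b\<close> differ, at most one indicator is 1 and a plain sum suffices.\<close>

lemma weight_2_entry: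
  fixes A :: "'a::{zero_neq_one,monoid_add} mat"
  assumes "zero_one_circulant n A" "residue_set A = {a, b}" "a \<noteq> b" "a < n" "b < n"
    and "i < n" "j < n"
  shows "A $$ (i, j) = (if j = nat ((int i + int a) mod int n) then 1 else 0)
                     + (if j = nat ((int i + int b) mod int n) then 1 else 0)"
    and "A $$ (i, j) = (if i = nat ((int j - int a) mod int n) then 1 else 0)
                     + (if i = nat ((int j - int b) mod int n) then 1 else 0)"
proof -
  define s where "s = nat ((int j - int i) mod int n)"
  \<comment> \<open>For a reduced residue, congruence is equality with a remainder; this is what
    solves \<open>s = c\<close> for \<open>j\<close> or for \<open>i\<close>.\<close>
  have cong_iff: "[int l = x] (mod int n) \<longleftrightarrow> l = nat (x mod int n)" if "l < n" for l x
  proof -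
    have "int l mod int n = int l" "x mod int n = int (nat (x mod int n))" using that by simp_all
    then show ?thesis unfolding cong_def by (metis of_nat_eq_iff)
  qed
  have *: "s = c \<longleftrightarrow> j = nat ((int i + int c) mod int n)"
          "s = c \<longleftrightarrow> i = nat ((int j - int c) mod int n)"
    if "c < n" for c
  proof -
    have "int c - (int j - int i) = - (int j - (int i + int c))"
         "int c - (int j - int i) = int i - (int j - int c)" by simp_all
    then have "[int c = int j - int i] (mod int n) \<longleftrightarrow> [int j = int i + int c] (mod int n)"
              "[int c = int j - int i] (mod int n) \<longleftrightarrow> [int i = int j - int c] (mod int n)"
      by (simp_all only: cong_iff_dvd_diff dvd_minus_iff)
    then show "s = c \<longleftrightarrow> j = nat ((int i + int c) mod int n)"
              "s = c \<longleftrightarrow> i = nat ((int j - int c) mod int n)"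
      unfolding s_def cong_iff[OF that] cong_iff[OF assms(6)] cong_iff[OF assms(7)] by (simp_all only: eq_commute[of c])
  qed
  have entry: "A $$ (i, j) = (if s = a then 1 else 0) + (if s = b then 1 else 0)"
    using assms(3) by (simp add: circulant_entry[OF assms(1,6,7)] assms(2) flip: s_def)
  show "A $$ (i, j) = (if j = nat ((int i + int a) mod int n) then 1 else 0)
                     + (if j = nat ((int i + int b) mod int n) then 1 else 0)"
    by (simp only: entry *(1)[OF assms(4)] *(1)[OF assms(5)])
  show "A $$ (i, j) = (if i = nat ((int j - int a) mod int n) then 1 else 0)
                     + (if i = nat ((int j - int b) mod int n) then 1 else 0)"
    by (simp only: entry *(2)[OF assms(4)] *(2)[OF assms(5)])
qed

section \<open>Periodic functions on the integers\<close>

lemma periodic_mult: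
  fixes f :: "int \<Rightarrow> 'a"
  assumes "\<And>i. f (i + k) = f i"
  shows "f (i + k * t) = f i"
proof -
  have pos: "f (i + k * int t) = f i" for i t
  proof (induction t arbitrary: i)
    case (Suc t)
    then show ?case using Suc[of "i + k"] assms[of i] by (simp add: algebra_simps)
  qed simp
  show ?thesis
  proof (cases "t \<ge> 0")
    case True
    then show ?thesis using pos[of i "nat t"] by simp
  next
    case False
    \<comment> \<open>For negative \<open>t\<close>, the nonnegative case starts at
      \<open>i + k * t\<close> and leads back to \<open>i\<close>.\<close>
    then show ?thesis using pos[of "i + k * t" "nat (- t)"] by simp
  qed
qed

text \<open>The periods of \<open>f\<close> form a subgroup of the integers, which contains the
  Bezout combination of \<open>n\<close> and \<open>k\<close>.\<close>

lemma periodic_gcd: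
  fixes f :: "int \<Rightarrow> 'a"
  assumes "\<And>i. f (i + n) = f i" "\<And>i. f (i + k) = f i"
  shows "f (i + gcd n k) = f i"
proof -
  obtain u v where "u * n + v * k = gcd n k" using bezout_int by blast
  then have "i + gcd n k = (i + n * u) + k * v" by (simp add: algebra_simps)
  then show ?thesis
    by (simp only: periodic_mult[of f k, OF assms(2)] periodic_mult[of f n, OF assms(1)])
qed

text \<open>The increments of \<open>f\<close> along \<open>k\<close> are \<open>k\<close>-periodic, so \<open>f (i + k * n) = f i + n * (f (i + k) - f i)\<close>;
  as \<open>f\<close> is also \<open>n\<close>-periodic, these increments vanish.\<close>

lemma periodic_second_difference_eq_0:
  fixes f :: "int \<Rightarrow> 'a::{ring_char_0,semiring_no_zero_divisors}"
  assumes "n > 0" "\<And>i. f (i + int n) = f i" "\<And>i. f (i + k) + f (i - k) = 2 * f i"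
  shows "f (i + k) = f i"
proof -
  have diff: "f (i + k + k) - f (i + k) = f (i + k) - f i" for i
    using assms(3)[of "i + k"] by (simp add: algebra_simps mult_2)
  have step: "f (i + k * int t + k) - f (i + k * int t) = f (i + k) - f i" for t
  proof (induction t)
    case (Suc t)
    have "f (i + k * int (Suc t) + k) - f (i + k * int (Suc t))
            = f (i + k * int t + k + k) - f (i + k * int t + k)"
      by (simp add: algebra_simps)
    then show ?case using diff[of "i + k * int t"] Suc by simp
  qed simp
  have "f (i + k * int t) = f i + of_nat t * (f (i + k) - f i)" for t
  proof (induction t)
    case (Suc t)
    have "f (i + k * int (Suc t)) = f (i + k * int t) + (f (i + k) - f i)"
      using step[of t] by (simp add: algebra_simps)
    then show ?case using Suc by (simp add: algebra_simps)
  qed simp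
  from this[of n] have "of_nat n * (f (i + k) - f i) = 0"
    using periodic_mult[of f "int n" i k, OF assms(2)] by (simp add: mult.commute)
  then show ?thesis using assms(1) by simp
qed

section \<open>Weight 2 circulants as sums of two cyclic shifts\<close>

lemma nat_mod_less: "n > 0 \<Longrightarrow> nat (i mod int n) < n"
  by (simp add: nat_less_iff)

text \<open>\<open>A\<close> is a sum of two permutation matrices, which shift the index by
  \<open>a\<close> and by \<open>b\<close>; transposition reverses both shifts.\<close>

lemma mult_mat_entry_weight_2:
  fixes A X :: "'a::semiring_1 mat"
  assumes A: "zero_one_circulant n A" "residue_set A = {a, b}" "a \<noteq> b" "a < n" "b < n"
    and X: "X \<in> carrier_mat n m" and ij: "i < n" "j < m"
  shows "(A * X) $$ (i, j) = X $$ (nat ((int i + int a) mod int n), j) + X $$ (nat ((int i + int b) mod int n), j)"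
    and "(transpose_mat A * X) $$ (i, j) = X $$ (nat ((int i - int a) mod int n), j) + X $$ (nat ((int i - int b) mod int n), j)"
proof -
  have n: "n > 0" using A by simp
  have AC: "A \<in> carrier_mat n n" using A(1) by (simp add: zero_one_circulant_def)
  have "(A * X) $$ (i, j) = (\<Sum>l<n. A $$ (i, l) * X $$ (l, j))"
    using AC X ij by (auto simp: scalar_prod_def atLeast0LessThan)
  also have "\<dots> = (\<Sum>l<n. (if l = nat ((int i + int a) mod int n) then X $$ (l, j) else 0)
                      + (if l = nat ((int i + int b) mod int n) then X $$ (l, j) else 0))"
    using ij by (intro sum.cong) (auto simp: weight_2_entry(1)[OF A] distrib_right)
  finally show "(A * X) $$ (i, j) = X $$ (nat ((int i + int a) mod int n), j) + X $$ (nat ((int i + int b) mod int n), j)"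
    using n by (simp add: sum.distrib nat_mod_less)
  have "(transpose_mat A * X) $$ (i, j) = (\<Sum>l<n. A $$ (l, i) * X $$ (l, j))"
    using AC X ij by (auto simp: scalar_prod_def atLeast0LessThan)
  also have "\<dots> = (\<Sum>l<n. (if l = nat ((int i - int a) mod int n) then X $$ (l, j) else 0)
                      + (if l = nat ((int i - int b) mod int n) then X $$ (l, j) else 0))"
    using ij by (intro sum.cong) (auto simp: weight_2_entry(2)[OF A] distrib_right)
  finally show "(transpose_mat A * X) $$ (i, j) = X $$ (nat ((int i - int a) mod int n), j) + X $$ (nat ((int i - int b) mod int n), j)"
    using n by (simp add: sum.distrib nat_mod_less)
qed

text \<open>Composing the shifts of \<open>A\<close> with the reversed ones gives four terms:
  \<open>a - a\<close> and \<open>b - b\<close> yield \<open>2 * f\<close>, and the mixed ones shift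
  by \<open>a - b\<close> and its negative. Extending column \<open>j\<close> to the
  \<open>n\<close>-periodic function \<open>f\<close> absorbs the wrap-around.\<close>

lemma gram_mult_entry_weight_2:
  fixes A X :: "'a::comm_ring_1 mat"
  assumes A: "zero_one_circulant n A" "residue_set A = {a, b}" "a \<noteq> b" "a < n" "b < n"
    and X: "X \<in> carrier_mat n m" and ij: "i < n" "j < m"
  defines "f \<equiv> \<lambda>i. X $$ (nat (i mod int n), j)"
  shows "(A * transpose_mat A * X) $$ (i, j)
           = 2 * f (int i) + f (int i + (int a - int b)) + f (int i - (int a - int b))"
proof -
  have n: "n > 0" using A by simp
  have AC: "A \<in> carrier_mat n n" using A(1) by (simp add: zero_one_circulant_def)
  then have TX: "transpose_mat A * X \<in> carrier_mat n m" using X by simp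
  have T: "(transpose_mat A * X) $$ (nat (l mod int n), j) = f (l - int a) + f (l - int b)" for l
    using n ij by (simp add: mult_mat_entry_weight_2(2)[OF A X] nat_mod_less f_def mod_simps)
  have "A * transpose_mat A * X = A * (transpose_mat A * X)"
    using AC X by (intro assoc_mult_mat) auto
  also have "\<dots> $$ (i, j) = 2 * f (int i) + f (int i + (int a - int b)) + f (int i - (int a - int b))"
    unfolding mult_mat_entry_weight_2(1)[OF A TX ij] T by (simp add: algebra_simps)
  finally show ?thesis .
qed

text \<open>This projection copies the entry at \<open>i mod d\<close> instead of averaging over a
  residue class, so no division is involved and the trace can be read off the diagonal.\<close>

definition periodic_projection :: "nat \<Rightarrow> nat \<Rightarrow> 'a::{zero,one} mat" where
  "periodic_projection n d = mat n n (\<lambda>(i, j). if j = i mod d then 1 else 0)"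

lemma periodic_projection_carrier [simp]: "periodic_projection n d \<in> carrier_mat n n"
  by (simp add: periodic_projection_def)

lemma periodic_projection_mult_entry:
  fixes X :: "'a::semiring_1 mat"
  assumes "X \<in> carrier_mat n m" "i < n" "j < m"
  shows "(periodic_projection n d * X) $$ (i, j) = X $$ (i mod d, j)"
proof -
  \<comment> \<open>This bound holds for every \<open>d\<close>, including \<open>d = 0\<close>,
    where \<open>i mod 0 = i\<close>.\<close>
  have "i mod d < n" using assms(2) by (meson le_less_trans mod_less_eq_dividend)
  have "(periodic_projection n d * X) $$ (i, j) = (\<Sum>l<n. (if l = i mod d then 1 else 0) * X $$ (l, j))"
    using assms by (simp add: periodic_projection_def scalar_prod_def atLeast0LessThan)
  also have "\<dots> = (\<Sum>l<n. if l = i mod d then X $$ (l, j) else 0)"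
    by (intro sum.cong) auto
  finally show ?thesis using \<open>i mod d < n\<close> by simp
qed

lemma periodic_projection_idem:
  "periodic_projection n d * periodic_projection n d = (periodic_projection n d :: 'a::semiring_1 mat)"
proof (rule eq_matI)
  fix i j assume "i < dim_row (periodic_projection n d :: 'a mat)" "j < dim_col (periodic_projection n d :: 'a mat)"
  then have ij: "i < n" "j < n" by (auto simp: periodic_projection_def)
  moreover have "i mod d < n" using ij by (meson le_less_trans mod_less_eq_dividend)
  ultimately show "(periodic_projection n d * periodic_projection n d) $$ (i, j) = (periodic_projection n d :: 'a mat) $$ (i, j)"
    by (simp add: periodic_projection_mult_entry[OF periodic_projection_carrier]) (simp add: periodic_projection_def)
qed (simp_all add: periodic_projection_def)

lemma trace_periodic_projection:
  assumes "d > 0" "d \<le> n"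
  shows "(\<Sum>i<n. periodic_projection n d $$ (i, i)) = (of_nat d :: 'a::semiring_1)"
proof -
  have "i = i mod d \<longleftrightarrow> i < d" for i using assms(1) by (metis mod_less mod_less_divisor)
  then have "(\<Sum>i<n. periodic_projection n d $$ (i, i)) = (\<Sum>i<n. if i \<in> {..<d} then 1 else 0 :: 'a)"
    by (intro sum.cong) (simp_all add: periodic_projection_def)
  also have "\<dots> = of_nat (card ({..<n} \<inter> {..<d}))" by (simp add: sum.If_cases lessThan_def)
  finally show ?thesis using assms(2) by (simp add: Int_absorb1)
qed

text \<open>In each column the equation becomes a vanishing second difference with step
  \<open>k = a - b\<close>. With \<open>n\<close>-periodicity this forces the period
  \<open>k\<close>, hence the period \<open>d\<close>; conversely \<open>d\<close> divides
  \<open>k\<close>. Allowing a matrix \<open>X\<close> of eigenvectors lets the projection itself be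
  substituted later.\<close>

lemma gram_eigen_4_iff:
  fixes A X :: "'a::{idom,ring_char_0} mat"
  assumes A: "zero_one_circulant n A" "residue_set A = {a, b}" "a \<noteq> b" "a < n" "b < n"
    and X: "X \<in> carrier_mat n m"
    and d: "int d = gcd (int n) (int a - int b)"
  shows "A * transpose_mat A * X = 4 \<cdot>\<^sub>m X \<longleftrightarrow> periodic_projection n d * X = X"
proof -
  define f where "f j i = X $$ (nat (i mod int n), j)" for i j
  define k where "k = int a - int b"
  have n: "n > 0" using A by simp
  have AC: "A \<in> carrier_mat n n" using A(1) by (simp add: zero_one_circulant_def)
  have fX: "f j (int i) = X $$ (i, j)" if "i < n" for i j using that by (simp add: f_def)
  have fn: "f j (i + int n) = f j i" for i j by (simp add: f_def)
  have fmod: "f j (i mod int n) = f j i" for i j by (simp add: f_def)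
  have entry: "(A * transpose_mat A * X) $$ (i, j) = 2 * f j (int i) + f j (int i + k) + f j (int i - k)"
    if "i < n" "j < m" for i j
    unfolding f_def k_def by (rule gram_mult_entry_weight_2[OF A X that])
  have mat_eq: "Y = Z \<longleftrightarrow> (\<forall>j<m. \<forall>i<n. Y $$ (i, j) = Z $$ (i, j))"
    if "Y \<in> carrier_mat n m" "Z \<in> carrier_mat n m" for Y Z :: "'a mat"
    using that by (auto simp: mat_eq_iff)
  have periodic_iff: "(\<forall>i<n. 2 * f j (int i) + f j (int i + k) + f j (int i - k) = 4 * f j (int i))
               \<longleftrightarrow> (\<forall>i<n. f j (int (i mod d)) = f j (int i))" for j
  proof
    assume L: "\<forall>i<n. 2 * f j (int i) + f j (int i + k) + f j (int i - k) = 4 * f j (int i)"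
    \<comment> \<open>The hypothesis covers only indices below \<open>n\<close>; reducing
      \<open>i\<close> modulo \<open>n\<close> extends it to all integers.\<close>
    have "f j (i + k) + f j (i - k) = 2 * f j i" for i
    proof -
      have "f j (i mod int n + k) = f j (i + k)" "f j (i mod int n - k) = f j (i - k)"
        by (simp_all add: f_def mod_simps)
      then show ?thesis
        using L[rule_format, of "nat (i mod int n)"] n by (simp add: nat_mod_less fmod)
    qed
    then have "f j (i + k) = f j i" for i
      by (rule periodic_second_difference_eq_0[of n "f j" k, OF n fn])
    then have per: "f j (i + int d) = f j i" for i
      unfolding d k_def[symmetric] using fn by (intro periodic_gcd)
    show "\<forall>i<n. f j (int (i mod d)) = f j (int i)"
    proof (intro allI impI)
      fix i
      have "int (i mod d) + int d * int (i div d) = int i"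
        by (simp add: zdiv_int zmod_int)
      then show "f j (int (i mod d)) = f j (int i)"
        using periodic_mult[of "f j" "int d" "int (i mod d)" "int (i div d)", OF per] by simp
    qed
  next
    assume R: "\<forall>i<n. f j (int (i mod d)) = f j (int i)"
    have "int d dvd int n" unfolding d by (rule gcd_dvd1)
    then have dn: "d dvd n" by simp
    \<comment> \<open>Since \<open>d\<close> divides \<open>n\<close>, reduction modulo
      \<open>n\<close> followed by reduction modulo \<open>d\<close> is reduction modulo
      \<open>d\<close>, which extends \<open>R\<close> to all integers.\<close>
    have fd: "f j i = f j (i mod int d)" for i
    proof -
      have "f j (int (nat (i mod int n) mod d)) = f j i"
        using R[rule_format, of "nat (i mod int n)"] n by (simp add: nat_mod_less fmod)
      moreover have "int (nat (i mod int n) mod d) = i mod int d"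
        using n dn by (simp add: zmod_int mod_mod_cancel)
      ultimately show ?thesis by simp
    qed
    have "int d dvd k" unfolding d k_def by (rule gcd_dvd2)
    then have mod: "(i + k) mod int d = i mod int d" "(i - k) mod int d = i mod int d" for i
      by (simp_all add: mod_eq_dvd_iff)
    have "f j (i + k) = f j i" "f j (i - k) = f j i" for i
      by (simp_all only: fd[of "i + k"] fd[of "i - k"] fd[of i] mod)
    then show "\<forall>i<n. 2 * f j (int i) + f j (int i + k) + f j (int i - k) = 4 * f j (int i)" by simp
  qed
  have "A * transpose_mat A * X = 4 \<cdot>\<^sub>m X \<longleftrightarrow>
          (\<forall>j<m. \<forall>i<n. 2 * f j (int i) + f j (int i + k) + f j (int i - k) = 4 * f j (int i))"
  proof -
    have "(4 \<cdot>\<^sub>m X) $$ (i, j) = 4 * f j (int i)" if "i < n" "j < m" for i j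
      using X that by (simp add: fX)
    moreover have "A * transpose_mat A * X \<in> carrier_mat n m" "4 \<cdot>\<^sub>m X \<in> carrier_mat n m"
      using AC X by simp_all
    ultimately show ?thesis
      by (simp only: mat_eq entry cong: imp_cong)
  qed
  also have "\<dots> \<longleftrightarrow> (\<forall>j<m. \<forall>i<n. f j (int (i mod d)) = f j (int i))"
    by (simp only: periodic_iff)
  also have "\<dots> \<longleftrightarrow> periodic_projection n d * X = X"
  proof -
    have "(periodic_projection n d * X) $$ (i, j) = f j (int (i mod d))" "X $$ (i, j) = f j (int i)"
      if "i < n" "j < m" for i j
      using periodic_projection_mult_entry[OF X that] fX le_less_trans[OF mod_less_eq_dividend that(1)]
        fX[OF that(1)] by simp_all
    then show ?thesis
      unfolding mat_eq[OF mult_carrier_mat[OF periodic_projection_carrier X] X] by metis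
  qed
  finally show ?thesis .
qed

section \<open>Trace and similarity\<close>

lemma trace_mult_commute:
  fixes X Y :: "'a::comm_semiring_1 mat"
  assumes "X \<in> carrier_mat n m" "Y \<in> carrier_mat m n"
  shows "(\<Sum>i<n. (X * Y) $$ (i, i)) = (\<Sum>i<m. (Y * X) $$ (i, i))"
proof -
  have "(\<Sum>i<n. (X * Y) $$ (i, i)) = (\<Sum>i<n. \<Sum>j<m. X $$ (i, j) * Y $$ (j, i))"
    using assms by (intro sum.cong) (auto simp: scalar_prod_def atLeast0LessThan)
  also have "\<dots> = (\<Sum>j<m. \<Sum>i<n. Y $$ (j, i) * X $$ (i, j))"
    by (subst sum.swap) (simp add: mult.commute)
  also have "\<dots> = (\<Sum>j<m. (Y * X) $$ (j, j))"
    using assms by (intro sum.cong) (auto simp: scalar_prod_def atLeast0LessThan)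
  finally show ?thesis .
qed

text \<open>\<open>P\<close> carries eigenvectors of \<open>N\<close> to eigenvectors of
  \<open>M\<close>. The form permits a second use with the roles of \<open>M\<close>,
  \<open>N\<close> and of \<open>P\<close>, \<open>Q\<close> exchanged.\<close>

lemma similar_eigen_transfer:
  fixes M N P Q X :: "'a::comm_ring_1 mat"
  assumes "M \<in> carrier_mat n n" "N \<in> carrier_mat n n" "P \<in> carrier_mat n n" "Q \<in> carrier_mat n n"
    and "Q * P = 1\<^sub>m n" "M = P * N * Q" and X: "X \<in> carrier_mat n m" "N * X = c \<cdot>\<^sub>m X"
  shows "M * (P * X) = c \<cdot>\<^sub>m (P * X)"
proof -
  have "M * (P * X) = P * N * (Q * P) * X"
    unfolding assms(6) using assms(1-4) X
    by (simp add: assoc_mult_mat[of _ n n _ n _ n] assoc_mult_mat[of _ n n _ n _ m])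
  also have "\<dots> = P * (N * X)"
    unfolding assms(5) using assms(2,3) X by (simp add: assoc_mult_mat[of _ n n _ n _ m])
  also have "\<dots> = c \<cdot>\<^sub>m (P * X)"
    unfolding X(2) using assms(3) X(1) by (simp add: mult_smult_distrib)
  finally show ?thesis .
qed

text \<open>If \<open>E\<close> and \<open>F\<close> project onto the eigenspaces of two similar matrices for the same eigenvalue,
  then up to the similarity \<open>E * F = F\<close> and \<open>F * E = E\<close>, so \<open>E\<close> and \<open>F\<close> have the same trace.\<close>

lemma similar_eigenprojection_trace_eq:
  fixes M N E F :: "'a::comm_ring_1 mat"
  assumes sim: "similar_mat M N" and M: "M \<in> carrier_mat n n"
    and E: "E \<in> carrier_mat n n" "\<And>X. X \<in> carrier_mat n n \<Longrightarrow> M * X = c \<cdot>\<^sub>m X \<longleftrightarrow> E * X = X" "E * E = E"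
    and F: "F \<in> carrier_mat n n" "\<And>X. X \<in> carrier_mat n n \<Longrightarrow> N * X = c \<cdot>\<^sub>m X \<longleftrightarrow> F * X = X" "F * F = F"
  shows "(\<Sum>i<n. E $$ (i, i)) = (\<Sum>i<n. F $$ (i, i))"
proof -
  obtain m P Q where mat: "{M, N, P, Q} \<subseteq> carrier_mat m m"
    and PQ: "P * Q = 1\<^sub>m m" "Q * P = 1\<^sub>m m" and eq: "M = P * N * Q"
    using similar_matD[OF sim] by blast
  have "m = n" using mat M by auto
  with mat PQ have N: "N \<in> carrier_mat n n" and P: "P \<in> carrier_mat n n" and Q: "Q \<in> carrier_mat n n"
    and PQ: "P * Q = 1\<^sub>m n" "Q * P = 1\<^sub>m n" by simp_all
  note assoc = assoc_mult_mat[of _ n n _ n _ n]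
  have cancel: "P * (Q * X) = X" "Q * (P * X) = X" if "X \<in> carrier_mat n n" for X
    using that P Q PQ assoc[OF P Q that] assoc[OF Q P that] by simp_all
  have eq': "N = Q * M * P"
    by (simp only: eq assoc N P Q mult_carrier_mat[of _ n n _ n] cancel PQ right_mult_one_mat[OF N])
  \<comment> \<open>Idempotence makes the columns of \<open>E\<close> themselves eigenvectors, so
    \<open>E\<close> may be taken for \<open>X\<close>; likewise \<open>F\<close> below.\<close>
  have "M * E = c \<cdot>\<^sub>m E" using E(2)[OF E(1)] E(3) by blast
  then have "N * (Q * E) = c \<cdot>\<^sub>m (Q * E)"
    by (rule similar_eigen_transfer[OF N M Q P PQ(1) eq' E(1)])
  then have FQE: "F * (Q * E) = Q * E" using F(2)[OF mult_carrier_mat[OF Q E(1)]] by blast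
  have "N * F = c \<cdot>\<^sub>m F" using F(2)[OF F(1)] F(3) by blast
  then have "M * (P * F) = c \<cdot>\<^sub>m (P * F)"
    by (rule similar_eigen_transfer[OF M N P Q PQ(2) eq F(1)])
  then have EPF: "E * (P * F) = P * F" using E(2)[OF mult_carrier_mat[OF P F(1)]] by blast
  \<comment> \<open>\<open>E\<close> is written as \<open>P * (Q * E)\<close> with \<open>F\<close>
    inserted. Cyclicity of the trace moves \<open>Q * E\<close> to the front, where \<open>E\<close>
    is absorbed and \<open>Q * P\<close> cancels.\<close>
  have "(\<Sum>i<n. E $$ (i, i)) = (\<Sum>i<n. (P * (F * (Q * E))) $$ (i, i))"
    by (simp only: FQE cancel[OF E(1)])
  also have "P * (F * (Q * E)) = (P * F) * (Q * E)"
    using P Q E(1) F(1) by (simp add: assoc)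
  also have "(\<Sum>i<n. ((P * F) * (Q * E)) $$ (i, i)) = (\<Sum>i<n. ((Q * E) * (P * F)) $$ (i, i))"
    using P Q E(1) F(1) by (intro trace_mult_commute) auto
  also have "(Q * E) * (P * F) = Q * (E * (P * F))"
    using P Q E(1) F(1) by (simp add: assoc)
  also have "\<dots> = F"
    by (simp only: EPF cancel[OF F(1)])
  finally show ?thesis .
qed

section \<open>Affine classes of weight 2\<close>

lemma affinely_equivalent_iff_gap_eq:
  assumes "zero_one_circulant n A" "weight A = 2" "zero_one_circulant n B" "weight B = 2"
  shows "affinely_equivalent n A B \<longleftrightarrow> gap n (residue_set A) = gap n (residue_set B)"
proof -
  obtain a b where A: "residue_set A = {a, b}" "a < n" "b < n"
    using weight_2_residue_set[OF assms(1,2)] by metis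
  obtain c e where B: "residue_set B = {c, e}" "c < n" "e < n"
    using weight_2_residue_set[OF assms(3,4)] by metis
  show ?thesis
    unfolding affinely_equivalent_def A(1) B(1) by (rule affine_image_pair_iff[OF A(2,3) B(2,3)])
qed

text \<open>An affine map with unit factor is injective modulo \<open>n\<close>. This is needed
  because \<open>affine_equivalence\<close> relates circulants of all weights, so the class of a
  weight 2 circulant must be shown to stay in weight 2.\<close>

lemma affinely_equivalent_weight:
  assumes A: "zero_one_circulant n A" and "affinely_equivalent n A B"
  shows "weight B = weight A"
proof -
  obtain u v where u: "coprime u n" and B: "residue_set B = (\<lambda>s. (u * s + v) mod n) ` residue_set A"
    using assms(2) unfolding affinely_equivalent_def by blast
  have "inj_on (\<lambda>s. (u * s + v) mod n) (residue_set A)"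
  proof (rule inj_onI)
    fix s t assume st: "s \<in> residue_set A" "t \<in> residue_set A"
      and "(u * s + v) mod n = (u * t + v) mod n"
    then have "[u * s = u * t] (mod n)"
      using cong_add_rcancel_nat[of "u * s" v "u * t" n] by (simp add: cong_def)
    then have "[s = t] (mod n)" using u by (simp add: cong_mult_lcancel_nat)
    moreover have "s < n" "t < n" using st residue_set_subset[OF A] by blast+
    ultimately show "s = t" by (simp add: cong_def)
  qed
  then show ?thesis by (simp add: weight_def B card_image)
qed

text \<open>A gap equal to \<open>n\<close> would make the two residues congruent modulo
  \<open>n\<close>, hence equal.\<close>

lemma gap_residue_set_weight_2:
  assumes "zero_one_circulant n A" "weight A = 2"
  shows "gap n (residue_set A) \<in> {d. d dvd n} - {n}"
proof -
  obtain a b where ab: "residue_set A = {a, b}" "a \<noteq> b" "a < n" "b < n"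
    using weight_2_residue_set[OF assms] by metis
  have "\<not> int n dvd int a - int b"
  proof
    assume "int n dvd int a - int b"
    then have "[int a = int b] (mod int n)" by (simp add: cong_iff_dvd_diff)
    then show False using ab by (simp add: cong_def)
  qed
  then have "gap n {a, b} \<noteq> n"
    using int_gap_pair[of n a b] by (metis gcd_dvd2)
  moreover have "gap n {a, b} dvd n" by (simp add: gap_def)
  ultimately show ?thesis by (simp add: ab(1))
qed

lemma exists_weight_2_circulant_gap:
  assumes "d dvd n" "d < n"
  shows "\<exists>A :: 'a::zero_neq_one mat. zero_one_circulant n A \<and> weight A = 2 \<and> gap n (residue_set A) = d"
proof -
  \<comment> \<open>The witness has residue set \<open>{0, d}\<close>, whose gap is
    \<open>gcd n d = d\<close>.\<close>
  define A :: "'a mat" where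
    "A = mat n n (\<lambda>(i, j). if (int j - int i) mod int n \<in> {0, int d} then 1 else 0)"
  have d: "d > 0" using assms by (cases d) auto
  have entry: "A $$ (i, j) = (if (int j - int i) mod int n \<in> {0, int d} then 1 else 0)"
    if "i < n" "j < n" for i j
    using that by (simp add: A_def)
  have "zero_one_circulant n A"
    unfolding zero_one_circulant_def
  proof (intro conjI allI impI)
    show "A \<in> carrier_mat n n" by (simp add: A_def)
    show "A $$ (i, j) \<in> {0, 1}" if "i < n" "j < n" for i j
      unfolding entry[OF that] by simp
    show "A $$ (i, j) = A $$ (i', j')"
      if "i < n" "j < n" "i' < n" "j' < n" "[int j - int i = int j' - int i'] (mod int n)"
      for i j i' j'
      unfolding entry[OF that(1,2)] entry[OF that(3,4)] using that(5) by (simp only: cong_def)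
  qed
  moreover have S: "residue_set A = {0, d}"
    using assms by (auto simp: residue_set_def A_def split: if_splits)
  moreover have "int (gap n {0, d}) = int d"
    unfolding int_gap_pair using assms by (simp add: gcd.commute)
  ultimately show ?thesis using d by (auto simp: weight_def intro!: exI[of _ A])
qed

text \<open>The classes are the fibres of the gap over the weight 2 circulants, and the gap takes
  exactly the proper divisors of \<open>n\<close> as values.\<close>

lemma card_affine_classes_weight_2:
  assumes "n > 0"
  shows "card ({A :: 'a::zero_neq_one mat. zero_one_circulant n A \<and> weight A = 2} // affine_equivalence n)
           = card {d. d dvd n} - 1"
proof -
  define W where "W = {A :: 'a mat. zero_one_circulant n A \<and> weight A = 2}"
  define fib where "fib d = {B \<in> W. gap n (residue_set B) = d}" for d
  have "affine_equivalence n `` {A} = fib (gap n (residue_set A))" if "A \<in> W" for A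
  proof -
    have A: "zero_one_circulant n A" "weight A = 2" using that by (simp_all add: W_def)
    have "(A, B) \<in> affine_equivalence n \<longleftrightarrow> B \<in> fib (gap n (residue_set A))" for B
    proof (cases "zero_one_circulant n B \<and> weight B = 2")
      case True
      then have B: "zero_one_circulant n B" "weight B = 2" by simp_all
      show ?thesis
        using A B by (simp add: affine_equivalence_def fib_def W_def
            affinely_equivalent_iff_gap_eq[OF A B] eq_commute)
    next
      case False
      then show ?thesis
        using A(2) affinely_equivalent_weight[OF A(1), of B]
        unfolding affine_equivalence_def fib_def W_def mem_Collect_eq prod.case by metis
    qed
    then show ?thesis by (simp only: set_eq_iff Image_singleton_iff simp_thms)
  qed
  then have "W // affine_equivalence n = fib ` (\<lambda>A. gap n (residue_set A)) ` W"
    unfolding quotient_def image_image by (simp add: UNION_singleton_eq_range)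
  also have "(\<lambda>A. gap n (residue_set A)) ` W = {d. d dvd n} - {n}"
  proof
    show "(\<lambda>A. gap n (residue_set A)) ` W \<subseteq> {d. d dvd n} - {n}"
      by (intro image_subsetI gap_residue_set_weight_2) (simp_all add: W_def)
    show "{d. d dvd n} - {n} \<subseteq> (\<lambda>A. gap n (residue_set A)) ` W"
    proof
      fix d assume "d \<in> {d. d dvd n} - {n}"
      then have "d dvd n" "d < n" using dvd_imp_le[of d n] assms by (simp_all add: nat_less_le)
      then obtain A :: "'a mat" where "A \<in> W" "gap n (residue_set A) = d"
        using exists_weight_2_circulant_gap[of d n, where 'a = 'a] unfolding W_def by blast
      then show "d \<in> (\<lambda>A. gap n (residue_set A)) ` W" by blast
    qed
  qed
  finally have quot: "W // affine_equivalence n = fib ` ({d. d dvd n} - {n})" .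
  \<comment> \<open>Each fibre is nonempty, and any member of it determines the divisor.\<close>
  have "inj_on fib ({d. d dvd n} - {n})"
  proof (rule inj_onI)
    fix d e assume "d \<in> {d. d dvd n} - {n}" and eq: "fib d = fib e"
    then have "d dvd n" "d < n" using dvd_imp_le[of d n] assms by (simp_all add: nat_less_le)
    then obtain A where "A \<in> fib d"
      using exists_weight_2_circulant_gap[of d n, where 'a = 'a] unfolding W_def fib_def by blast
    then have "A \<in> fib d" "A \<in> fib e" using eq by simp_all
    then show "d = e" unfolding fib_def by simp
  qed
  then have "card (W // affine_equivalence n) = card ({d. d dvd n} - {n})"
    unfolding quot by (rule card_image)
  also have "\<dots> = card {d. d dvd n} - 1"
    by (intro card_Diff_singleton CollectI dvd_refl)
  finally show ?thesis unfolding W_def .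
qed

text \<open>Each gap is the trace of a projection onto the eigenspace for 4, and similarity
  preserves this trace. Characteristic 0 then recovers the natural number from its image under
  \<open>of_nat\<close>.\<close>

lemma gap_eq_if_similar_gram:
  fixes A B :: "'a::{idom,ring_char_0} mat"
  assumes A: "zero_one_circulant n A" "weight A = 2" and B: "zero_one_circulant n B" "weight B = 2"
    and sim: "similar_mat (A * transpose_mat A) (B * transpose_mat B)"
  shows "gap n (residue_set A) = gap n (residue_set B)"
proof -
  obtain a b where ab: "residue_set A = {a, b}" "a \<noteq> b" "a < n" "b < n"
    using weight_2_residue_set[OF A] by metis
  obtain c e where ce: "residue_set B = {c, e}" "c \<noteq> e" "c < n" "e < n"
    using weight_2_residue_set[OF B] by metis
  have n: "n > 0" using ab by simp
  have bounds: "0 < gap n S" "gap n S \<le> n" for S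
    using n by (simp_all add: gap_def)
  have carrier: "A * transpose_mat A \<in> carrier_mat n n"
    using A by (simp add: zero_one_circulant_def mult_carrier_mat[of _ n n])
  have eigA: "A * transpose_mat A * X = 4 \<cdot>\<^sub>m X \<longleftrightarrow> periodic_projection n (gap n {a, b}) * X = X"
    if "X \<in> carrier_mat n n" for X
    by (rule gram_eigen_4_iff[OF A(1) ab that int_gap_pair])
  have eigB: "B * transpose_mat B * X = 4 \<cdot>\<^sub>m X \<longleftrightarrow> periodic_projection n (gap n {c, e}) * X = X"
    if "X \<in> carrier_mat n n" for X
    by (rule gram_eigen_4_iff[OF B(1) ce that int_gap_pair])
  note similar_eigenprojection_trace_eq[OF sim carrier periodic_projection_carrier eigA
      periodic_projection_idem periodic_projection_carrier eigB periodic_projection_idem]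
  then have "(of_nat (gap n {a, b}) :: 'a) = of_nat (gap n {c, e})"
    by (simp only: trace_periodic_projection bounds)
  then show ?thesis by (simp add: ab(1) ce(1))
qed

theorem theorem3p1:
  fixes n :: nat
  assumes "n \<ge> 1"
  shows "card ({A :: complex mat. zero_one_circulant n A \<and> weight A = 2} // affine_equivalence n)
           = card {d. d dvd n} - 1
       \<and> (\<forall>A B :: complex mat.
            zero_one_circulant n A \<and> weight A = 2 \<and>
            zero_one_circulant n B \<and> weight B = 2 \<and>
            \<not> affinely_equivalent n A B \<longrightarrow>
            \<not> similar_mat (A * transpose_mat A) (B * transpose_mat B))"
proof
  show "card ({A :: complex mat. zero_one_circulant n A \<and> weight A = 2} // affine_equivalence n)
          = card {d. d dvd n} - 1"
    using assms by (intro card_affine_classes_weight_2) simp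
  show "\<forall>A B :: complex mat.
            zero_one_circulant n A \<and> weight A = 2 \<and>
            zero_one_circulant n B \<and> weight B = 2 \<and>
            \<not> affinely_equivalent n A B \<longrightarrow>
            \<not> similar_mat (A * transpose_mat A) (B * transpose_mat B)"
  proof (intro allI impI notI, elim conjE)
    fix A B :: "complex mat"
    assume A: "zero_one_circulant n A" "weight A = 2" and B: "zero_one_circulant n B" "weight B = 2"
      and "\<not> affinely_equivalent n A B"
      and "similar_mat (A * transpose_mat A) (B * transpose_mat B)"
    then show False
      using gap_eq_if_similar_gram[OF A B] affinely_equivalent_iff_gap_eq[OF A B] by blast
  qed
qed

end
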